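(* Every expansion of $(\mathbb{R},<,+)$ that defines a Cantor set defines $\mathcal{B}$.
   Context: A Cantor set is a subset of $\mathbb{R}$ that is nonempty, compact, and has neither isolated points nor interior points. $\mathcal{B}$ denotes the two-sorted first order structure $(\mathcal{P}(\mathbb{N}),\mathbb{N},\in,+1)$, where $\mathcal{P}(\mathbb{N})$ is the power set of $\mathbb{N}$, $\in$ is the membership relation between $\mathbb{N}$ and $\mathcal{P}(\mathbb{N})$, and $+1$ is the successor function on $\mathbb{N}$. "Definable" means first order definable with parameters. A structure with underlying set $\mathbb{R}$ "defines $\mathcal{B}$" if it defines an isomorphic copy of $\mathcal{B}$: there are definable sets $N', P'$ (subsets of Cartesian powers of $\mathbb{R}$), a definable relation $\epsilon \subseteq N' \times P'$ and a definable function $s: N' \to N'$ such that the two-sorted structure $(P',N',\epsilon,s)$ is isomorphic to $\mathcal{B}$. *)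

theory Defs
  imports "HOL-Analysis.Analysis"
begin

datatype 'f trm = Var nat | App 'f "'f trm list"

datatype ('f, 'r) fm =
    Eq "'f trm" "'f trm"
  | Rel 'r "'f trm list"
  | Neg "('f, 'r) fm"
  | Conj "('f, 'r) fm" "('f, 'r) fm"
  | Exists nat "('f, 'r) fm"

text \<open>A first-order structure with underlying set all of \<open>'a\<close>. The symbols of its language are
  all elements of the types \<open>'f\<close> and \<open>'r\<close>. Interpretations matter only on argument lists of the
  length given by the arity, since only well-formed formulas are considered below.\<close>

record ('f, 'r, 'a) struct =
  fun_arity :: "'f \<Rightarrow> nat"
  rel_arity :: "'r \<Rightarrow> nat"
  fun_interp :: "'f \<Rightarrow> 'a list \<Rightarrow> 'a"
  rel_interp :: "'r \<Rightarrow> 'a list \<Rightarrow> bool"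

primrec wf_trm :: "('f, 'r, 'a) struct \<Rightarrow> 'f trm \<Rightarrow> bool" where
  "wf_trm M (Var i) \<longleftrightarrow> True"
| "wf_trm M (App f ts) \<longleftrightarrow> length ts = fun_arity M f \<and> list_all (wf_trm M) ts"

primrec wf_fm :: "('f, 'r, 'a) struct \<Rightarrow> ('f, 'r) fm \<Rightarrow> bool" where
  "wf_fm M (Eq s t) \<longleftrightarrow> wf_trm M s \<and> wf_trm M t"
| "wf_fm M (Rel R ts) \<longleftrightarrow> length ts = rel_arity M R \<and> list_all (wf_trm M) ts"
| "wf_fm M (Neg \<phi>) \<longleftrightarrow> wf_fm M \<phi>"
| "wf_fm M (Conj \<phi> \<psi>) \<longleftrightarrow> wf_fm M \<phi> \<and> wf_fm M \<psi>"
| "wf_fm M (Exists i \<phi>) \<longleftrightarrow> wf_fm M \<phi>"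

primrec val :: "('f, 'r, 'a) struct \<Rightarrow> (nat \<Rightarrow> 'a) \<Rightarrow> 'f trm \<Rightarrow> 'a" where
  "val M e (Var i) = e i"
| "val M e (App f ts) = fun_interp M f (map (val M e) ts)"

primrec sat :: "('f, 'r, 'a) struct \<Rightarrow> (nat \<Rightarrow> 'a) \<Rightarrow> ('f, 'r) fm \<Rightarrow> bool" where
  "sat M e (Eq s t) \<longleftrightarrow> val M e s = val M e t"
| "sat M e (Rel R ts) \<longleftrightarrow> rel_interp M R (map (val M e) ts)"
| "sat M e (Neg \<phi>) \<longleftrightarrow> \<not> sat M e \<phi>"
| "sat M e (Conj \<phi> \<psi>) \<longleftrightarrow> sat M e \<phi> \<and> sat M e \<psi>"
| "sat M e (Exists i \<phi>) \<longleftrightarrow> (\<exists>a. sat M (e(i := a)) \<phi>)"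

text \<open>The \<open>n\<close>-th Cartesian power of \<open>'a\<close> is the set of lists of length \<open>n\<close>. Variables
  \<open>0, \<dots>, n - 1\<close> stand for the coordinates; the values \<open>p i\<close> with \<open>n \<le> i\<close> are the parameters,
  only finitely many of which are used since a formula has finitely many variables.\<close>

definition definable :: "('f, 'r, 'a) struct \<Rightarrow> nat \<Rightarrow> 'a list set \<Rightarrow> bool" where
  "definable M n S \<longleftrightarrow>
     (\<exists>\<phi> p. wf_fm M \<phi> \<and>
        S = {xs. length xs = n \<and> sat M (\<lambda>i. if i < n then xs ! i else p i) \<phi>})"

definition expansion_of_real_less_plus :: "('f, 'r, real) struct \<Rightarrow> bool" where
  "expansion_of_real_less_plus M \<longleftrightarrow>
     (\<exists>less. rel_arity M less = 2 \<and> (\<forall>x y. rel_interp M less [x, y] \<longleftrightarrow> x < y)) \<and>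
     (\<exists>plus. fun_arity M plus = 2 \<and> (\<forall>x y. fun_interp M plus [x, y] = x + y))"

definition cantor_set :: "real set \<Rightarrow> bool" where
  "cantor_set C \<longleftrightarrow>
     C \<noteq> {} \<and> compact C \<and> (\<nexists>x. x isolated_in C) \<and> interior C = {}"

definition defines_cantor_set :: "('f, 'r, real) struct \<Rightarrow> bool" where
  "defines_cantor_set M \<longleftrightarrow> (\<exists>C. cantor_set C \<and> definable M 1 ((\<lambda>x. [x]) ` C))"

record ('p, 'n) two_sorted =
  set_sort :: "'p set"
  num_sort :: "'n set"
  memb :: "('n \<times> 'p) set"
  succ :: "'n \<Rightarrow> 'n"

definition two_sorted_structure :: "('p, 'n) two_sorted \<Rightarrow> bool" where
  "two_sorted_structure A \<longleftrightarrow>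
     memb A \<subseteq> num_sort A \<times> set_sort A \<and> succ A \<in> num_sort A \<rightarrow> num_sort A"

definition two_sorted_iso :: "('p, 'n) two_sorted \<Rightarrow> ('q, 'm) two_sorted \<Rightarrow> bool" where
  "two_sorted_iso A B \<longleftrightarrow>
     (\<exists>f g. bij_betw f (set_sort A) (set_sort B) \<and> bij_betw g (num_sort A) (num_sort B) \<and>
        (\<forall>n\<in>num_sort A. \<forall>X\<in>set_sort A. (n, X) \<in> memb A \<longleftrightarrow> (g n, f X) \<in> memb B) \<and>
        (\<forall>n\<in>num_sort A. g (succ A n) = succ B (g n)))"

definition structB :: "(nat set, nat) two_sorted" where
  "structB = \<lparr>set_sort = UNIV, num_sort = UNIV, memb = {(n, X). n \<in> X}, succ = Suc\<rparr>"

text \<open>A relation between \<open>N'\<close> and \<open>P'\<close> (resp. the graph of a function \<open>N' \<Rightarrow> N'\<close>) is turned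
  into a subset of a Cartesian power by concatenating tuples.\<close>

definition definable_two_sorted ::
    "('f, 'r, 'a) struct \<Rightarrow> ('a list, 'a list) two_sorted \<Rightarrow> bool" where
  "definable_two_sorted M A \<longleftrightarrow>
     two_sorted_structure A \<and>
     (\<exists>k l. definable M k (num_sort A) \<and> definable M l (set_sort A) \<and>
        definable M (k + l) {x @ y | x y. (x, y) \<in> memb A} \<and>
        definable M (k + k) {x @ succ A x | x. x \<in> num_sort A})"

definition defines_structB :: "('f, 'r, 'a) struct \<Rightarrow> bool" where
  "defines_structB M \<longleftrightarrow> (\<exists>A. definable_two_sorted M A \<and> two_sorted_iso A structB)"

end

theory Submission
  imports Defs
begin

text \<open>
  Let \<open>C\<close> be the Cantor set. A gap is a bounded interval of the complement of \<open>C\<close> with both end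
  points in \<open>C\<close>. For a scale \<open>s > 0\<close> only finitely many gaps have length at least \<open>s\<close>, so cutting
  \<open>C\<close> at these gaps leaves finitely many pieces. The addition on the reals serves to compare
  lengths of gaps that lie in different places, and this is enough to define \<open>\<B>\<close>.

  The numbers are the members of a definable set of scales \<open>s 0 > s 1 > \<dots>\<close> that is lacunary:
  each piece at scale \<open>s n\<close> contains a gap of length at least \<open>s (n + 1)\<close>, so that it is cut
  further before the next scale. Such a set is obtained from the gaps which are closer to a real
  number \<open>y\<close>, on its right, than their own length. The point \<open>y\<close> is a parameter. It is the limit of
  a decreasing sequence of gaps, each of which is chosen so close to its predecessor, and
  hence so short, that the lengths decrease as fast as lacunarity demands
  (lemma \<open>lacunary_near_lengths\<close>).

  The sets of numbers are coded by points of \<open>C\<close>. The \<open>n\<close>-th digit of a point \<open>x\<close> tells whether \<open>x\<close>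
  lies in the leftmost of the pieces at scale \<open>s (n + 1)\<close> into which its piece at scale \<open>s n\<close> is
  cut. Lacunarity means that there are always at least two of them, so the digits can be prescribed
  independently of each other, and every set of numbers is the digit set of a point. Among the
  points with the same digits there is a least one (lemma \<open>least_element_with_digits\<close>), and
  keeping only these least points makes the coding bijective. All these notions are first order in
  \<open><\<close>, \<open>+\<close> and \<open>C\<close>.
\<close>

section \<open>Gaps and pieces of a Cantor set\<close>

definition gap :: "real set \<Rightarrow> real \<Rightarrow> real \<Rightarrow> bool" where
  "gap C a b \<longleftrightarrow> a \<in> C \<and> b \<in> C \<and> a < b \<and> (\<forall>c\<in>C. \<not> (a < c \<and> c < b))"

text \<open>For \<open>p\<close> and \<open>q\<close> in \<open>C\<close> with \<open>p \<le> q\<close>, this says that they lie in different pieces at scale \<open>s\<close>.\<close>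

definition wide :: "real set \<Rightarrow> real \<Rightarrow> real \<Rightarrow> real \<Rightarrow> bool" where
  "wide C s p q \<longleftrightarrow> (\<exists>a b. gap C a b \<and> p \<le> a \<and> b \<le> q \<and> a + s \<le> b)"

definition piece_start :: "real set \<Rightarrow> real \<Rightarrow> real \<Rightarrow> bool" where
  "piece_start C s p \<longleftrightarrow> p \<in> C \<and> ((\<forall>q\<in>C. p \<le> q) \<or> (\<exists>a. gap C a p \<and> a + s \<le> p))"

lemma gap_cases: "gap C a b \<Longrightarrow> c \<in> C \<Longrightarrow> c \<le> a \<or> b \<le> c"
  unfolding gap_def by force

lemma gap_less: "gap C a b \<Longrightarrow> a < b"
  unfolding gap_def by simp

lemma gap_mem: "gap C a b \<Longrightarrow> a \<in> C" "gap C a b \<Longrightarrow> b \<in> C"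
  unfolding gap_def by simp_all

lemma wide_mono: "wide C s p q \<Longrightarrow> t \<le> s \<Longrightarrow> p' \<le> p \<Longrightarrow> q \<le> q' \<Longrightarrow> wide C t p' q'"
  unfolding wide_def by (meson add_left_mono order_trans)

lemma wide_split: "wide C s p q \<Longrightarrow> c \<in> C \<Longrightarrow> wide C s p c \<or> wide C s c q"
  unfolding wide_def by (meson gap_cases)

lemma wide_bound: "wide C s p q \<Longrightarrow> p + s \<le> q"
  unfolding wide_def by force

lemma piece_start_antimono: "piece_start C s p \<Longrightarrow> t \<le> s \<Longrightarrow> piece_start C t p"
  unfolding piece_start_def by force

lemma piece_start_wide:
  "piece_start C s p \<Longrightarrow> q \<in> C \<Longrightarrow> q < p \<Longrightarrow> wide C s q p"
  unfolding piece_start_def wide_def by (metis gap_cases linorder_not_le order_refl)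

text \<open>A gap surrounds every point between \<open>p\<close> and \<open>q\<close> that is missing from \<open>C\<close>, and there is such a
  point because \<open>C\<close> has no interior.\<close>

lemma gap_between:
  assumes C: "cantor_set C" and pq: "p \<in> C" "q \<in> C" "p < q"
  obtains a b where "gap C a b" "p \<le> a" "b \<le> q"
proof -
  have cC: "compact C" and int: "interior C = {}"
    using C by (auto simp: cantor_set_def)
  have "\<not> {p<..<q} \<subseteq> C"
    using interior_maximal[of "{p<..<q}" C] int pq(3) by auto
  then obtain w where w: "p < w" "w < q" "w \<notin> C"
    unfolding subset_iff greaterThanLessThan_iff by blast
  have "compact (C \<inter> {..w})" "compact (C \<inter> {w..})"
    using cC by (auto intro: compact_Int_closed)
  moreover have "C \<inter> {..w} \<noteq> {}" "C \<inter> {w..} \<noteq> {}" using pq w by auto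
  ultimately obtain a b where a: "a \<in> C \<inter> {..w}" "\<forall>c\<in>C \<inter> {..w}. c \<le> a"
    and b: "b \<in> C \<inter> {w..}" "\<forall>c\<in>C \<inter> {w..}. b \<le> c"
    using compact_attains_sup compact_attains_inf by metis
  have "a < w" "w < b" using a b w by (auto simp: less_le)
  then have "gap C a b" unfolding gap_def using a b
    by (smt (verit) IntD1 IntI atLeast_iff atMost_iff)
  then show ?thesis using that a b pq w by auto
qed

lemma cantor_accumulates:
  assumes C: "cantor_set C" and p: "p \<in> C" and e: "0 < e"
  obtains c where "c \<in> C" "c \<noteq> p" "\<bar>c - p\<bar> < e"
proof -
  have "\<not> p isolated_in C" using C by (auto simp: cantor_set_def)
  then show ?thesis
    using p e that unfolding isolated_in_dist_Ex_iff dist_real_def by fastforce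
qed

lemma cantor_accumulates_left_of_gap:
  assumes C: "cantor_set C" and g: "gap C a b" and e: "0 < e"
  obtains c where "c \<in> C" "a - e < c" "c < a"
proof -
  obtain c where "c \<in> C" "c \<noteq> a" "\<bar>c - a\<bar> < min e (b - a)"
    using cantor_accumulates[OF C gap_mem(1)[OF g], of "min e (b - a)"] e gap_less[OF g] by auto
  then show ?thesis using that gap_cases[OF g] by fastforce
qed

text \<open>A piece is perfect, and its first point can only be approached from the right. This supplies
  arbitrarily short gaps directly behind that point.\<close>

lemma cantor_accumulates_right_of_start:
  assumes C: "cantor_set C" and p: "piece_start C s p" and s: "0 < s"
  obtains c where "c \<in> C" "p < c" "c < p + s"
proof -
  obtain c where c: "c \<in> C" "c \<noteq> p" "\<bar>c - p\<bar> < s"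
    using cantor_accumulates[OF C _ s] p by (auto simp: piece_start_def)
  have "\<not> c < p"
    using piece_start_wide[OF p c(1)] wide_bound[of C s c p] c by force
  then show ?thesis using that c by auto
qed

text \<open>Gaps are disjoint and \<open>C\<close> is bounded. Right end points of distinct gaps of length at least \<open>s\<close>
  differ by at least \<open>s\<close>, so rounding them down to multiples of \<open>s\<close> separates them.\<close>

lemma finite_wide_gaps:
  assumes C: "cantor_set C" and s: "0 < s"
  shows "finite {(a, b). gap C a b \<and> a + s \<le> b}" (is "finite ?G")
proof (rule finite_imageD)
  obtain r where r: "\<forall>x\<in>C. \<bar>x\<bar> \<le> r"
    using C compact_imp_bounded bounded_real by (metis cantor_set_def)
  show "inj_on (\<lambda>(a, b). \<lfloor>b / s\<rfloor>) ?G"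
  proof (rule inj_onI, clarsimp)
    fix a b a' b'
    assume g: "gap C a b" "gap C a' b'" and w: "a + s \<le> b" "a' + s \<le> b'"
      and eq: "\<lfloor>b / s\<rfloor> = \<lfloor>b' / s\<rfloor>"
    have sep: "\<not> y + s \<le> z" if "\<lfloor>y / s\<rfloor> = \<lfloor>z / s\<rfloor>" for y z
    proof
      assume "y + s \<le> z"
      then have "(y + s) / s \<le> z / s" using s by (intro divide_right_mono) auto
      then have "y / s + 1 \<le> z / s" using s by (simp add: add_divide_distrib)
      then show False using that by linarith
    qed
    have "b = b'"
      using sep[of b b'] sep[of b' b] eq w gap_cases[OF g(1) gap_mem(2)[OF g(2)]]
        gap_cases[OF g(1) gap_mem(1)[OF g(2)]] gap_cases[OF g(2) gap_mem(1)[OF g(1)]]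
        gap_cases[OF g(2) gap_mem(2)[OF g(1)]] gap_less[OF g(1)] gap_less[OF g(2)]
      by argo
    moreover have "a = a'"
      using \<open>b = b'\<close> gap_cases[OF g(1) gap_mem(1)[OF g(2)]] gap_cases[OF g(2) gap_mem(1)[OF g(1)]]
        gap_less[OF g(1)] gap_less[OF g(2)] by argo
    ultimately show "a = a' \<and> b = b'" by simp
  qed
  have "(\<lambda>(a, b). \<lfloor>b / s\<rfloor>) ` ?G \<subseteq> {\<lfloor>- r / s\<rfloor>..\<lfloor>r / s\<rfloor>}"
  proof -
    have "\<lfloor>- r / s\<rfloor> \<le> \<lfloor>b / s\<rfloor>" "\<lfloor>b / s\<rfloor> \<le> \<lfloor>r / s\<rfloor>" if "gap C a b" for a b
    proof -
      have "\<bar>b\<bar> \<le> r" using r gap_mem(2)[OF that] by blast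
      then show "\<lfloor>- r / s\<rfloor> \<le> \<lfloor>b / s\<rfloor>" "\<lfloor>b / s\<rfloor> \<le> \<lfloor>r / s\<rfloor>"
        using s by (intro floor_mono divide_right_mono; simp)+
    qed
    then show ?thesis by auto
  qed
  then show "finite ((\<lambda>(a, b). \<lfloor>b / s\<rfloor>) ` ?G)"
    by (rule finite_subset) simp
qed

text \<open>All pieces at scale \<open>s\<close> are split at a common finer scale \<open>d\<close>, because there are only finitely
  many of them. The bound \<open>b < p + s\<close> keeps the splitting gap inside the piece that starts at \<open>p\<close>.\<close>

lemma gap_at_start:
  assumes C: "cantor_set C" and s: "0 < s"
  obtains d where "0 < d"
    "\<And>p. piece_start C s p \<Longrightarrow> \<exists>a b. gap C a b \<and> p \<le> a \<and> b < p + s \<and> a + d \<le> b"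
proof -
  obtain m where m: "m \<in> C" "\<forall>q\<in>C. m \<le> q"
    using C compact_attains_inf by (metis cantor_set_def)
  have "{p. piece_start C s p} \<subseteq> insert m (snd ` {(a, b). gap C a b \<and> a + s \<le> b})"
  proof
    fix p assume "p \<in> {p. piece_start C s p}"
    then consider "p \<in> C" "\<forall>q\<in>C. p \<le> q" | a where "gap C a p" "a + s \<le> p"
      by (auto simp: piece_start_def)
    then show "p \<in> insert m (snd ` {(a, b). gap C a b \<and> a + s \<le> b})"
      using m by cases (force simp: image_iff)+
  qed
  then have fin: "finite {p. piece_start C s p}"
    using finite_wide_gaps[OF C s] by (meson finite_imageI finite_insert finite_subset)
  have "\<exists>d>0. \<exists>a b. gap C a b \<and> p \<le> a \<and> b < p + s \<and> a + d \<le> b" if p: "piece_start C s p" for p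
  proof -
    obtain c where c: "c \<in> C" "p < c" "c < p + s"
      using cantor_accumulates_right_of_start[OF C p s] .
    have "p \<in> C" using p by (simp add: piece_start_def)
    then obtain a b where g: "gap C a b" "p \<le> a" "b \<le> c"
      using gap_between[OF C _ c(1,2)] by blast
    then show ?thesis using c gap_less[OF g(1)] by (intro exI[of _ "b - a"]) force
  qed
  then obtain d where d: "\<And>p. piece_start C s p \<Longrightarrow> d p > 0"
      "\<And>p. piece_start C s p \<Longrightarrow> \<exists>a b. gap C a b \<and> p \<le> a \<and> b < p + s \<and> a + d p \<le> b"
    by metis
  define D where "D = Min (insert 1 (d ` {p. piece_start C s p}))"
  have "D > 0" unfolding D_def using fin d(1) by (subst Min_gr_iff) auto
  moreover have "D \<le> d p" if "piece_start C s p" for p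
    unfolding D_def using fin that by (intro Min_le) auto
  ultimately show ?thesis using that[of D] d(2) by (meson add_left_mono order_trans)
qed

text \<open>Take the rightmost among the longest gaps between \<open>c\<close> and \<open>d\<close>. The gaps to its right are
  strictly shorter; this is what keeps unwanted gaps out of the set of scales constructed below.\<close>

lemma dominant_gap:
  assumes C: "cantor_set C" and cd: "c \<in> C" "d \<in> C" "c < d"
  obtains a b where "gap C a b" "c \<le> a" "b \<le> d"
    "\<And>a' b'. gap C a' b' \<Longrightarrow> b \<le> a' \<Longrightarrow> b' \<le> d \<Longrightarrow> b' - a' < b - a"
proof -
  obtain a0 b0 where g0: "gap C a0 b0" "c \<le> a0" "b0 \<le> d"
    using gap_between[OF C cd] .
  define G where "G = {(a, b). gap C a b \<and> c \<le> a \<and> b \<le> d \<and> a + (b0 - a0) \<le> b}"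
  have finG: "finite G"
    by (rule finite_subset[OF _ finite_wide_gaps[OF C, of "b0 - a0"]])
       (use gap_less[OF g0(1)] in \<open>auto simp: G_def\<close>)
  have "(a0, b0) \<in> G" using g0 by (simp add: G_def)
  define L where "L = Max ((\<lambda>(a, b). b - a) ` G)"
  have L: "b - a \<le> L" if "(a, b) \<in> G" for a b
    unfolding L_def using finG that by (intro Max_ge) force+
  have "L \<in> (\<lambda>(a, b). b - a) ` G"
    unfolding L_def using finG \<open>(a0, b0) \<in> G\<close> by (intro Max_in) auto
  then obtain a1 b1 where 1: "(a1, b1) \<in> G" "b1 - a1 = L" by auto
  define H where "H = {b. (b - L, b) \<in> G}"
  have "H \<subseteq> snd ` G" by (force simp: H_def)
  then have finH: "finite H" using finG finite_subset by blast
  have "b1 \<in> H" using 1 unfolding H_def by (smt (verit) mem_Collect_eq)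
  define b where "b = Max H"
  have "b \<in> H" unfolding b_def using finH \<open>b1 \<in> H\<close> by (intro Max_in) auto
  then have g: "gap C (b - L) b" "c \<le> b - L" "b \<le> d" "b0 - a0 \<le> L" by (auto simp: H_def G_def)
  have "b' - a' < L" if g': "gap C a' b'" "b \<le> a'" "b' \<le> d" for a' b'
  proof (rule ccontr)
    assume n: "\<not> b' - a' < L"
    then have "(a', b') \<in> G" using g g' gap_less[OF g(1)] by (auto simp: G_def)
    moreover from this have "b' - a' = L" using L n by force
    moreover from this have "a' = b' - L" by simp
    ultimately have "b' \<in> H" by (simp add: H_def)
    then have "b' \<le> b" unfolding b_def using finH by (intro Max_ge)
    then show False using g' gap_less by fastforce
  qed
  then show ?thesis using that[OF g(1-3)] by simp
qed

section \<open>A definable lacunary sequence of scales\<close>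

definition lacunary :: "real set \<Rightarrow> (nat \<Rightarrow> real) \<Rightarrow> bool" where
  "lacunary C s \<longleftrightarrow> (\<forall>n. 0 < s n \<and> s (Suc n) < s n \<and>
     (\<forall>p. piece_start C (s n) p \<longrightarrow>
        (\<exists>a b. gap C a b \<and> p \<le> a \<and> b < p + s n \<and> a + s (Suc n) \<le> b)))"

text \<open>The parameter \<open>u\<close> cuts off the gaps far to the right of \<open>y\<close>, over which the choice of \<open>y\<close> has no
  control.\<close>

definition near_lengths :: "real set \<Rightarrow> real \<Rightarrow> real \<Rightarrow> real set" where
  "near_lengths C y u = {s. \<exists>a b. gap C a b \<and> a + s = b \<and> y \<le> a \<and> a \<le> u \<and> a < y + s}"

lemma initial_gap:
  assumes C: "cantor_set C"
  obtains a b where "gap C a b"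
proof -
  obtain p where p: "p \<in> C" using C by (auto simp: cantor_set_def)
  obtain c where "c \<in> C" "c \<noteq> p" using cantor_accumulates[OF C p, of 1] by auto
  then show ?thesis using that gap_between[OF C] p by (metis linorder_neqE_linordered_idom)
qed

text \<open>Choose gaps \<open>(a n, b n)\<close> moving to the left, together with points \<open>c n < a n\<close> of \<open>C\<close> which
  confine all later gaps to the right of \<open>c n\<close>. If \<open>a n - c n\<close> is small compared with the length of
  the \<open>n\<close>-th gap, then that gap is near to the limit \<open>y\<close> of the \<open>a n\<close>, and all later chosen gaps
  are as short as lacunarity requires. Taking each new gap dominant ensures that a gap between two
  successive chosen ones is shorter than the chosen one on its left, hence shorter than its
  distance from \<open>y\<close>, and does not contribute a scale.\<close>

lemma lacunary_near_lengths:
  assumes C: "cantor_set C"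
  obtains y u s where "lacunary C s" "near_lengths C y u = range s"
proof -
  have "\<exists>d. 0 < s \<longrightarrow> 0 < d \<and> (\<forall>p. piece_start C s p \<longrightarrow>
      (\<exists>a b. gap C a b \<and> p \<le> a \<and> b < p + s \<and> a + d \<le> b))" for s
    using gap_at_start[OF C, of s] by metis
  then obtain \<delta> where \<delta>: "\<And>s. 0 < s \<Longrightarrow> 0 < \<delta> s"
    "\<And>s p. 0 < s \<Longrightarrow> piece_start C s p \<Longrightarrow>
        \<exists>a b. gap C a b \<and> p \<le> a \<and> b < p + s \<and> a + \<delta> s \<le> b"
    by metis
  \<comment> \<open>The triple consists of the confining point and the two ends of a gap.\<close>
  define good where "good = (\<lambda>(c, a, b). gap C a b \<and> c \<in> C \<and> c < a \<and>
      a - c < b - a \<and> a - c < \<delta> (b - a))"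
  define step :: "real \<times> real \<times> real \<Rightarrow> real \<times> real \<times> real \<Rightarrow> bool"
    where "step = (\<lambda>(c, a, b) (c', a', b'). c < c' \<and> b' \<le> a \<and>
      (\<forall>x z. gap C x z \<longrightarrow> b' \<le> x \<longrightarrow> z \<le> a \<longrightarrow> z - x < b' - a'))"
  have extend: "\<exists>c'. c0 < c' \<and> good (c', a, b)" if g: "gap C a b" "c0 < a" for a b c0
  proof -
    have "0 < min (a - c0) (min (b - a) (\<delta> (b - a)))"
      using gap_less[OF g(1)] \<delta>(1) g(2) by auto
    from cantor_accumulates_left_of_gap[OF C g(1) this] obtain c where
      "c \<in> C" "a - min (a - c0) (min (b - a) (\<delta> (b - a))) < c" "c < a" .
    then show ?thesis using g by (auto simp: good_def intro!: exI[of _ c])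
  qed
  have "\<exists>f. \<forall>n. good (f n) \<and> step (f n) (f (Suc n))"
  proof (rule dependent_nat_choice)
    obtain a b where "gap C a b" using initial_gap[OF C] .
    then show "\<exists>x. good x" using extend[of a b "a - 1"] by auto
  next
    fix x n assume "good x"
    obtain c a b where x: "x = (c, a, b)" by (cases x)
    have g: "gap C a b" "c \<in> C" "c < a" using \<open>good x\<close> by (auto simp: x good_def)
    have "0 < a - c" using g by simp
    then obtain c1 where c1: "c1 \<in> C" "c < c1" "c1 < a"
      using cantor_accumulates_left_of_gap[OF C g(1), of "a - c"] by force
    obtain a' b' where g': "gap C a' b'" "c1 \<le> a'" "b' \<le> a"
      "\<And>x z. gap C x z \<Longrightarrow> b' \<le> x \<Longrightarrow> z \<le> a \<Longrightarrow> z - x < b' - a'"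
      using dominant_gap[OF C c1(1) gap_mem(1)[OF g(1)] c1(3)] by metis
    obtain c' where "c < c'" "good (c', a', b')"
      using extend[OF g'(1), of c] g' c1 by auto
    then show "\<exists>y. good y \<and> step x y"
      using g' by (intro exI[of _ "(c', a', b')"]) (auto simp: step_def x)
  qed
  then obtain f where f: "\<And>n. good (f n)" "\<And>n. step (f n) (f (Suc n))" by metis
  define c a b where "c = (\<lambda>n. fst (f n))" and "a = (\<lambda>n. fst (snd (f n)))"
    and "b = (\<lambda>n. snd (snd (f n)))"
  have feq: "f n = (c n, a n, b n)" for n by (simp add: c_def a_def b_def)
  have g: "gap C (a n) (b n)" "c n \<in> C" "c n < a n" "a n - c n < b n - a n"
      "a n - c n < \<delta> (b n - a n)" for n
    using f(1)[of n] by (auto simp: good_def feq)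
  have st: "c n < c (Suc n)" "b (Suc n) \<le> a n"
      "\<And>x z. gap C x z \<Longrightarrow> b (Suc n) \<le> x \<Longrightarrow> z \<le> a n \<Longrightarrow> z - x < b (Suc n) - a (Suc n)" for n
    using f(2)[of n] by (auto simp: step_def feq)
  have lt: "a n < b n" for n using gap_less[OF g(1)] .
  have adec: "a (Suc n) < a n" for n using st(2)[of n] lt[of "Suc n"] by simp
  define s where "s = (\<lambda>n. b n - a n)"
  have spos: "0 < s n" for n using lt by (simp add: s_def)
  have cmono: "mono c" using st(1) by (intro incseq_SucI less_imp_le)
  have aanti: "antimono a" using adec by (intro decseq_SucI less_imp_le)
  have ca: "c n < a m" for n m
    using monoD[OF cmono, of n "max n m"] antimonoD[OF aanti, of m "max n m"] g(3)[of "max n m"]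
    by simp
  have ssmall: "s (Suc n) < a n - c n" for n
    using st(2)[of n] ca[of n "Suc n"] by (simp add: s_def)
  have lac: "lacunary C s"
    unfolding lacunary_def
  proof (intro allI conjI impI)
    fix n p
    show "0 < s n" by (rule spos)
    show "s (Suc n) < s n" using ssmall[of n] g(4)[of n] by (simp add: s_def)
    assume "piece_start C (s n) p"
    from \<delta>(2)[OF spos this] show
      "\<exists>a b. gap C a b \<and> p \<le> a \<and> b < p + s n \<and> a + s (Suc n) \<le> b"
      using ssmall[of n] g(5)[of n] unfolding s_def by force
  qed
  define y where "y = Inf (range a)"
  have bdd: "bdd_below (range a)" using ca[of 0] by (auto intro!: bdd_belowI[of _ "c 0"] less_imp_le)
  have ya: "y < a n" for n
    using cInf_lower[OF rangeI bdd, of "Suc n"] adec[of n] by (simp add: y_def)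
  have cy: "c n \<le> y" for n
    unfolding y_def using ca by (intro cInf_greatest) (auto intro: less_imp_le)
  have "near_lengths C y (a 0) = range s"
  proof (intro equalityI subsetI)
    fix t assume "t \<in> range s"
    then obtain n where "t = s n" by blast
    moreover have "a n \<le> a 0" using antimonoD[OF aanti, of 0 n] by simp
    ultimately show "t \<in> near_lengths C y (a 0)"
      unfolding near_lengths_def mem_Collect_eq using g(1,4)[of n] ya[of n] cy[of n]
      by (intro exI[of _ "a n"] exI[of _ "b n"]) (auto simp: s_def)
  next
    fix t assume "t \<in> near_lengths C y (a 0)"
    then obtain p q where pq: "gap C p q" "p + t = q" "y \<le> p" "p \<le> a 0" "p < y + t"
      by (auto simp: near_lengths_def)
    have "\<exists>n. a n \<le> p"
    proof (rule ccontr)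
      assume "\<not> (\<exists>n. a n \<le> p)"
      then have "q \<le> a n" for n using gap_cases[OF pq(1) gap_mem(1)[OF g(1)], of n] by auto
      then have "q \<le> y" unfolding y_def by (intro cInf_greatest) auto
      then show False using pq gap_less[OF pq(1)] by simp
    qed
    \<comment> \<open>The first chosen gap that does not lie to the right of \<open>p\<close>. It begins at \<open>p\<close>: otherwise the
      gap at \<open>p\<close> lies strictly between two successive chosen ones.\<close>
    define n where "n = (LEAST n. a n \<le> p)"
    have n: "a n \<le> p" unfolding n_def using \<open>\<exists>n. a n \<le> p\<close> by (rule LeastI_ex)
    have "p = a n"
    proof (cases n)
      case 0
      then show ?thesis using n pq by simp
    next
      case (Suc m)
      then have "p < a m" using not_less_Least[of m "\<lambda>n. a n \<le> p"] by (auto simp: n_def)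
      show ?thesis
      proof (rule ccontr)
        assume "p \<noteq> a n"
        then have "b n \<le> p" using n gap_cases[OF g(1)[of n] gap_mem(1)[OF pq(1)]] by auto
        moreover have "q \<le> a m"
          using gap_cases[OF pq(1) gap_mem(1)[OF g(1)], of m] \<open>p < a m\<close> by auto
        ultimately have "q - p < b n - a n" using st(3)[of p q m] pq(1) Suc by auto
        then show False using pq(2,5) ya[of n] \<open>b n \<le> p\<close> by linarith
      qed
    qed
    then have "q = b n"
      using gap_cases[OF g(1)[of n] gap_mem(2)[OF pq(1)]] gap_cases[OF pq(1) gap_mem(2)[OF g(1)[of n]]]
        gap_less[OF pq(1)] lt[of n] by linarith
    then have "t = s n" using \<open>p = a n\<close> pq(2) by (simp add: s_def)
    then show "t \<in> range s" by simp
  qed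
  then show ?thesis using that lac by blast
qed

section \<open>Points with prescribed digits\<close>

text \<open>Here \<open>t < s\<close> is the next finer scale. The condition says that no gap of length at least \<open>t\<close> lies
  between \<open>x\<close> and the start of its piece at scale \<open>s\<close>, in other words that \<open>x\<close> lies in the leftmost
  subpiece at scale \<open>t\<close>. This form avoids speaking about the start of the piece.\<close>

definition digit :: "real set \<Rightarrow> real \<Rightarrow> real \<Rightarrow> real \<Rightarrow> bool" where
  "digit C s t x \<longleftrightarrow> (\<forall>p\<in>C. wide C t p x \<longrightarrow> wide C s p x)"

lemma digit_if_not_wide:
  assumes "piece_start C s p" "\<not> wide C t p x" "p \<le> x"
  shows "digit C s t x"
  unfolding digit_def
proof (intro ballI impI)
  fix q assume q: "q \<in> C" "wide C t q x"
  then have "q < p" using assms(2) wide_mono[of C t q x t p x] by force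
  then show "wide C s q x"
    using piece_start_wide[OF assms(1) q(1)] wide_mono[of C s q p s q x] assms(3) by blast
qed

text \<open>Follow the starts \<open>p n\<close> of the pieces at scale \<open>s n\<close> to which the point has to belong: stay at
  \<open>p n\<close> if the \<open>n\<close>-th digit has to be true, and otherwise move to the right end of the first gap
  behind \<open>p n\<close> of length at least \<open>s (n + 1)\<close>. By lacunarity this gap belongs to the same piece at
  scale \<open>s n\<close>. The limit of the \<open>p n\<close> has the required digits. It is the least such point because a
  point with these digits cannot precede any of the \<open>p n\<close>.\<close>

lemma least_element_with_digits:
  assumes C: "cantor_set C" and lac: "lacunary C s"
  obtains x where "x \<in> C" "\<And>n. digit C (s n) (s (Suc n)) x \<longleftrightarrow> n \<in> A"
    "\<And>z. z \<in> C \<Longrightarrow> (\<And>n. digit C (s n) (s (Suc n)) z \<longleftrightarrow> n \<in> A) \<Longrightarrow> x \<le> z"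
proof -
  have spos: "0 < s n" and sdec: "s (Suc n) < s n" for n
    using lac by (auto simp: lacunary_def)
  have santi: "antimono s" using sdec by (intro decseq_SucI less_imp_le)
  obtain m where m: "m \<in> C" "\<forall>q\<in>C. m \<le> q"
    using C compact_attains_inf by (metis cantor_set_def)
  define ends where "ends = (\<lambda>n q. {b. \<exists>a. gap C a b \<and> q \<le> a \<and> a + s (Suc n) \<le> b})"
  define p where "p = rec_nat m (\<lambda>n q. if n \<in> A then q else Min (ends n q))"
  have p0: "p 0 = m" and pSuc: "p (Suc n) = (if n \<in> A then p n else Min (ends n (p n)))" for n
    by (simp_all add: p_def)
  have fin: "finite (ends n q)" for n q
    by (rule finite_subset[OF _ finite_imageI[OF finite_wide_gaps[OF C spos[of "Suc n"]], of snd]])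
       (force simp: ends_def image_iff)
  have next_end: "Min (ends n q) \<in> ends n q \<and> Min (ends n q) < q + s n"
    if "piece_start C (s n) q" for n q
  proof -
    obtain a b where "gap C a b" "q \<le> a" "b < q + s n" "a + s (Suc n) \<le> b"
      using lac \<open>piece_start C (s n) q\<close> unfolding lacunary_def by blast
    then have "b \<in> ends n q" by (auto simp: ends_def)
    then show ?thesis using Min_in[OF fin[of n q]] Min_le[OF fin[of n q]] \<open>b < q + s n\<close> by force
  qed
  have start: "piece_start C (s n) (p n)" for n
  proof (induction n)
    case 0
    then show ?case using m by (simp add: p0 piece_start_def)
  next
    case (Suc n)
    show ?case
    proof (cases "n \<in> A")
      case True
      then show ?thesis using piece_start_antimono[OF Suc, of "s (Suc n)"] sdec[of n]
        by (simp add: pSuc)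
    next
      case False
      then show ?thesis using next_end[OF Suc]
        by (auto simp: pSuc ends_def piece_start_def gap_mem)
    qed
  qed
  have pC: "p n \<in> C" for n using start[of n] by (simp add: piece_start_def)
  have step: "p n \<le> p (Suc n) \<and> p (Suc n) < p n + s n" for n
    using next_end[OF start[of n]] spos[of n] by (force simp: pSuc ends_def dest: gap_less)
  have pmono: "mono p" using step by (intro incseq_SucI) auto
  \<comment> \<open>All later starts remain in the piece at scale \<open>s n\<close> that begins at \<open>p n\<close>.\<close>
  have narrow: "\<not> wide C (s n) (p n) (p (n + j))" for n j
  proof (induction j)
    case 0
    then show ?case using wide_bound[of C "s n" "p n" "p n"] spos[of n] by force
  next
    case (Suc j)
    have "\<not> wide C (s n) (p (n + j)) (p (n + Suc j))"
      using wide_bound[of C "s n" "p (n + j)" "p (n + Suc j)"] step[of "n + j"]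
        antimonoD[OF santi, of n "n + j"] by force
    then show ?case using Suc wide_split[OF _ pC[of "n + j"]] by blast
  qed
  define x where "x = Sup (range p)"
  have "bounded C" "closed C" using C by (auto simp: cantor_set_def compact_imp_bounded compact_imp_closed)
  then have bdd: "bdd_above (range p)"
    using bounded_imp_bdd_above bdd_above_mono pC by (metis image_subsetI)
  have px: "p n \<le> x" for n unfolding x_def using bdd by (intro cSup_upper) auto
  have "p \<longlonglongrightarrow> x"
    unfolding x_def using LIMSEQ_incseq_SUP[OF bdd pmono] .
  then have xC: "x \<in> C" using closed_sequentially[OF \<open>closed C\<close>, of p x] pC by blast
  have narrow_x: "\<not> wide C (s n) (p n) x" for n
  proof
    assume "wide C (s n) (p n) x"
    then obtain a b where ab: "gap C a b" "p n \<le> a" "b \<le> x" "a + s n \<le> b"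
      by (auto simp: wide_def)
    have "\<exists>k. a < p k"
      using less_cSup_iff[of "range p" a] bdd ab gap_less[OF ab(1)] by (auto simp: x_def)
    then obtain k where "a < p k" ..
    then have "b \<le> p k" using gap_cases[OF ab(1) pC] by force
    moreover have "n \<le> k"
      using \<open>a < p k\<close> ab(2) monoD[OF pmono, of k n] by (cases "n \<le> k") auto
    ultimately show False using narrow[of n "k - n"] ab by (auto simp: wide_def)
  qed
  have digits: "digit C (s n) (s (Suc n)) x \<longleftrightarrow> n \<in> A" for n
  proof
    assume "n \<in> A"
    then show "digit C (s n) (s (Suc n)) x"
      using digit_if_not_wide[OF start _ px] narrow_x[of "Suc n"] by (simp add: pSuc)
  next
    assume d: "digit C (s n) (s (Suc n)) x"
    show "n \<in> A"
    proof (rule ccontr)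
      assume "n \<notin> A"
      then have "p (Suc n) \<in> ends n (p n)" using next_end[OF start[of n]] by (simp add: pSuc)
      then have "wide C (s (Suc n)) (p n) x"
        using px[of "Suc n"] by (auto simp: ends_def wide_def)
      then show False using d narrow_x[of n] pC[of n] by (auto simp: digit_def)
    qed
  qed
  have "x \<le> z" if z: "z \<in> C" "\<And>n. digit C (s n) (s (Suc n)) z \<longleftrightarrow> n \<in> A" for z
  proof -
    have "p n \<le> z" for n
    proof (induction n)
      case 0
      then show ?case using m z by (simp add: p0)
    next
      case (Suc n)
      show ?case
      proof (cases "n \<in> A")
        case True
        then show ?thesis using Suc by (simp add: pSuc)
      next
        case False
        then have "wide C (s (Suc n)) (p n) z"
          using digit_if_not_wide[OF start _ Suc] z(2)[of n] by blast
        then obtain b where "b \<in> ends n (p n)" "b \<le> z" by (auto simp: wide_def ends_def)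
        then show ?thesis using False Min_le[OF fin, of b n "p n"] by (simp add: pSuc)
      qed
    qed
    then show ?thesis unfolding x_def by (intro cSup_least) auto
  qed
  then show ?thesis using that xC digits by blast
qed

section \<open>First-order formulas with parameters\<close>

text \<open>Definability of a set of tuples reserves the first variables for the coordinates and gives the
  other ones to the parameters. Formulas are combined more easily if neither kind of variable is
  limited in number: the variable \<open>2 * i\<close> stands for the \<open>i\<close>-th entry of an assignment that can be
  varied, and \<open>2 * i + 1\<close> for the \<open>i\<close>-th parameter. Passing between the two conventions means renaming
  the variables by an injection.\<close>

primrec rename_trm :: "(nat \<Rightarrow> nat) \<Rightarrow> 'f trm \<Rightarrow> 'f trm" where
  "rename_trm r (Var i) = Var (r i)"
| "rename_trm r (App f ts) = App f (map (rename_trm r) ts)"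

primrec rename_fm :: "(nat \<Rightarrow> nat) \<Rightarrow> ('f, 'r) fm \<Rightarrow> ('f, 'r) fm" where
  "rename_fm r (Eq s t) = Eq (rename_trm r s) (rename_trm r t)"
| "rename_fm r (Rel R ts) = Rel R (map (rename_trm r) ts)"
| "rename_fm r (Neg \<phi>) = Neg (rename_fm r \<phi>)"
| "rename_fm r (Conj \<phi> \<psi>) = Conj (rename_fm r \<phi>) (rename_fm r \<psi>)"
| "rename_fm r (Exists i \<phi>) = Exists (r i) (rename_fm r \<phi>)"

lemma wf_rename_trm: "wf_trm M (rename_trm r t) \<longleftrightarrow> wf_trm M t"
  by (induction t) (auto simp: list_all_iff)

lemma wf_rename_fm: "wf_fm M (rename_fm r \<phi>) \<longleftrightarrow> wf_fm M \<phi>"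
  by (induction \<phi>) (auto simp: list_all_iff wf_rename_trm)

lemma val_rename_trm: "val M e (rename_trm r t) = val M (\<lambda>i. e (r i)) t"
proof (induction t)
  case (App f ts)
  then have "map (val M e) (map (rename_trm r) ts) = map (val M (\<lambda>i. e (r i))) ts" by simp
  then show ?case by (simp del: map_map)
qed simp

text \<open>Injectivity prevents a renamed free variable from being captured by a quantifier.\<close>

lemma sat_rename_fm: "inj r \<Longrightarrow> sat M e (rename_fm r \<phi>) \<longleftrightarrow> sat M (\<lambda>i. e (r i)) \<phi>"
proof (induction \<phi> arbitrary: e)
  case (Rel R ts)
  have "val M e \<circ> rename_trm r = val M (\<lambda>i. e (r i))"
    by (simp add: fun_eq_iff val_rename_trm)
  then show ?case by simp
next
  case (Exists i \<phi>)
  have "(\<lambda>j. (e(r i := a)) (r j)) = (\<lambda>j. e (r j))(i := a)" for a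
    using \<open>inj r\<close> by (auto simp: fun_eq_iff inj_eq)
  then show ?case using Exists by simp
qed (simp_all add: val_rename_trm)

definition interleave :: "(nat \<Rightarrow> 'a) \<Rightarrow> (nat \<Rightarrow> 'a) \<Rightarrow> nat \<Rightarrow> 'a" where
  "interleave e p i = (if even i then e (i div 2) else p (i div 2))"

lemma interleave_upd: "(interleave e p)(2 * i := a) = interleave (e(i := a)) p"
  by (auto simp: fun_eq_iff interleave_def elim!: evenE)

definition expressible :: "('f, 'r, 'a) struct \<Rightarrow> (nat \<Rightarrow> 'a) \<Rightarrow> ((nat \<Rightarrow> 'a) \<Rightarrow> bool) \<Rightarrow> bool" where
  "expressible M p Q \<longleftrightarrow> (\<exists>\<phi>. wf_fm M \<phi> \<and> (\<forall>e. Q e \<longleftrightarrow> sat M (interleave e p) \<phi>))"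

definition expressible_trm :: "('f, 'r, 'a) struct \<Rightarrow> (nat \<Rightarrow> 'a) \<Rightarrow> ((nat \<Rightarrow> 'a) \<Rightarrow> 'a) \<Rightarrow> bool" where
  "expressible_trm M p t \<longleftrightarrow> (\<exists>\<tau>. wf_trm M \<tau> \<and> (\<forall>e. t e = val M (interleave e p) \<tau>))"

lemma expressible_not: "expressible M p Q \<Longrightarrow> expressible M p (\<lambda>e. \<not> Q e)"
  unfolding expressible_def by (metis wf_fm.simps(3) sat.simps(3))

lemma expressible_conj:
  "expressible M p Q \<Longrightarrow> expressible M p R \<Longrightarrow> expressible M p (\<lambda>e. Q e \<and> R e)"
  unfolding expressible_def by (metis wf_fm.simps(4) sat.simps(4))

lemma expressible_imp:
  "expressible M p Q \<Longrightarrow> expressible M p R \<Longrightarrow> expressible M p (\<lambda>e. Q e \<longrightarrow> R e)"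
  using expressible_not[OF expressible_conj[OF _ expressible_not]] by fastforce

lemma expressible_iff:
  "expressible M p Q \<Longrightarrow> expressible M p R \<Longrightarrow> expressible M p (\<lambda>e. Q e \<longleftrightarrow> R e)"
  unfolding iff_conv_conj_imp by (intro expressible_conj expressible_imp)

text \<open>The second assumption says that the variable chosen for the quantifier does not occur elsewhere.\<close>

lemma expressible_ex:
  assumes "expressible M p (\<lambda>e. Q e (e m))" "\<And>e a b. Q (e(m := b)) a \<longleftrightarrow> Q e a"
  shows "expressible M p (\<lambda>e. \<exists>a. Q e a)"
proof -
  obtain \<phi> where \<phi>: "wf_fm M \<phi>" "\<And>e. Q e (e m) \<longleftrightarrow> sat M (interleave e p) \<phi>"
    using assms(1) by (auto simp: expressible_def)
  have "(\<exists>a. Q e a) \<longleftrightarrow> sat M (interleave e p) (Exists (2 * m) \<phi>)" for e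
    using \<phi>(2)[of "e(m := _)"] assms(2) by (simp add: interleave_upd)
  then show ?thesis unfolding expressible_def using \<phi>(1) by (metis wf_fm.simps(5))
qed

lemma expressible_all:
  assumes "expressible M p (\<lambda>e. Q e (e m))" "\<And>e a b. Q (e(m := b)) a \<longleftrightarrow> Q e a"
  shows "expressible M p (\<lambda>e. \<forall>a. Q e a)"
proof -
  have "expressible M p (\<lambda>e. \<exists>a. \<not> Q e a)"
    using expressible_not[OF assms(1)] assms(2) by (intro expressible_ex[where m = m]) auto
  from expressible_not[OF this] show ?thesis by simp
qed

lemma expressible_trm_var: "expressible_trm M p (\<lambda>e. e i)"
  unfolding expressible_trm_def by (intro exI[of _ "Var (2 * i)"]) (simp add: interleave_def)

lemma expressible_trm_param: "expressible_trm M p (\<lambda>e. p i)"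
  unfolding expressible_trm_def by (intro exI[of _ "Var (2 * i + 1)"]) (simp add: interleave_def)

lemma expressible_trm_add:
  fixes M :: "('f, 'r, real) struct"
  assumes "expansion_of_real_less_plus M" "expressible_trm M p s" "expressible_trm M p t"
  shows "expressible_trm M p (\<lambda>e. s e + t e)"
proof -
  obtain plus where plus: "fun_arity M plus = 2" "\<And>x y. fun_interp M plus [x, y] = x + y"
    using assms(1) by (auto simp: expansion_of_real_less_plus_def)
  obtain \<sigma> \<tau> where "wf_trm M \<sigma>" "\<forall>e. s e = val M (interleave e p) \<sigma>"
    "wf_trm M \<tau>" "\<forall>e. t e = val M (interleave e p) \<tau>"
    using assms(2,3) by (auto simp: expressible_trm_def)
  then show ?thesis
    unfolding expressible_trm_def using plus by (intro exI[of _ "App plus [\<sigma>, \<tau>]"]) simp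
qed

lemma expressible_less:
  fixes M :: "('f, 'r, real) struct"
  assumes "expansion_of_real_less_plus M" "expressible_trm M p s" "expressible_trm M p t"
  shows "expressible M p (\<lambda>e. s e < t e)"
proof -
  obtain less where less: "rel_arity M less = 2" "\<And>x y. rel_interp M less [x, y] \<longleftrightarrow> x < y"
    using assms(1) by (auto simp: expansion_of_real_less_plus_def)
  obtain \<sigma> \<tau> where "wf_trm M \<sigma>" "\<forall>e. s e = val M (interleave e p) \<sigma>"
    "wf_trm M \<tau>" "\<forall>e. t e = val M (interleave e p) \<tau>"
    using assms(2,3) by (auto simp: expressible_trm_def)
  then show ?thesis
    unfolding expressible_def using less by (intro exI[of _ "Rel less [\<sigma>, \<tau>]"]) simp
qed

lemma expressible_le:
  fixes M :: "('f, 'r, real) struct"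
  assumes "expansion_of_real_less_plus M" "expressible_trm M p s" "expressible_trm M p t"
  shows "expressible M p (\<lambda>e. s e \<le> t e)"
  using expressible_not[OF expressible_less[OF assms(1,3,2)]] by (simp add: not_less)

lemma expressible_eq:
  assumes "expressible_trm M p s" "expressible_trm M p t"
  shows "expressible M p (\<lambda>e. s e = t e)"
  using assms unfolding expressible_def expressible_trm_def by (metis wf_fm.simps(1) sat.simps(1))

text \<open>The formula that defines \<open>S\<close> brings its own parameters \<open>q\<close>; they are stored in \<open>p\<close> from position
  \<open>k\<close> onwards, which leaves room for further parameters.\<close>

lemma expressible_mem:
  assumes S: "S = {x. sat M (\<lambda>i. if i < 1 then x else q i) \<phi>}" and \<phi>: "wf_fm M \<phi>"
    and p: "\<And>i. p (i + k) = q i"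
  shows "expressible M p (\<lambda>e. e j \<in> S)"
proof -
  \<comment> \<open>The coordinate of the given formula becomes variable \<open>j\<close>, its parameters become those of \<open>p\<close>.\<close>
  define r where "r i = (if i = 0 then 2 * j else 2 * (i + k) + 1)" for i :: nat
  have "inj r"
  proof (rule injI)
    fix x y assume "r x = r y"
    then show "x = y" unfolding r_def by (auto split: if_splits) presburger+
  qed
  have "(\<lambda>i. interleave e p (r i)) = (\<lambda>i. if i < 1 then e j else q i)" for e
    by (auto simp: fun_eq_iff interleave_def r_def p)
  then have "e j \<in> S \<longleftrightarrow> sat M (interleave e p) (rename_fm r \<phi>)" for e
    by (simp add: S sat_rename_fm[OF \<open>inj r\<close>])
  then show ?thesis
    unfolding expressible_def using \<phi> wf_rename_fm by blast
qed

text \<open>The entries \<open>p i\<close> with \<open>i \<ge> n\<close> are a mere default value for assignments that do not come from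
  the tuple; every such entry is turned into a parameter.\<close>

lemma definable_if_expressible:
  fixes M :: "('f, 'r, 'a) struct"
  assumes "expressible M p Q"
  shows "definable M n {xs. length xs = n \<and> Q (\<lambda>i. if i < n then xs ! i else p i)}"
proof -
  obtain \<phi> where \<phi>: "wf_fm M \<phi>" "\<And>e. Q e \<longleftrightarrow> sat M (interleave e p) \<phi>"
    using assms by (auto simp: expressible_def)
  define r where "r i = (if even i \<and> i div 2 < n then i div 2 else i + n)" for i
  have "inj r"
  proof (rule injI)
    fix x y assume "r x = r y"
    then show "x = y" unfolding r_def by (auto split: if_splits elim!: evenE)
  qed
  have "interleave (\<lambda>i. if i < n then xs ! i else p i) p =
      (\<lambda>i. if r i < n then xs ! r i else interleave p p (r i - n))" for xs :: "'a list"
    by (auto simp: fun_eq_iff r_def interleave_def)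
  then have "Q (\<lambda>i. if i < n then xs ! i else p i) \<longleftrightarrow>
      sat M (\<lambda>i. if i < n then xs ! i else interleave p p (i - n)) (rename_fm r \<phi>)" for xs
    by (simp add: \<phi>(2) sat_rename_fm[OF \<open>inj r\<close>])
  then show ?thesis
    unfolding definable_def using \<phi>(1) wf_rename_fm
    by (intro exI[of _ "rename_fm r \<phi>"] exI[of _ "\<lambda>i. interleave p p (i - n)"]) auto
qed

section \<open>Definable coding of sets of scales\<close>

definition next_below :: "real set \<Rightarrow> real \<Rightarrow> real \<Rightarrow> bool" where
  "next_below S s t \<longleftrightarrow> s \<in> S \<and> t \<in> S \<and> t < s \<and> (\<forall>r\<in>S. r < s \<longrightarrow> r \<le> t)"

definition digit_at :: "real set \<Rightarrow> real set \<Rightarrow> real \<Rightarrow> real \<Rightarrow> bool" where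
  "digit_at C S s x \<longleftrightarrow> (\<exists>t. next_below S s t \<and> digit C s t x)"

text \<open>One canonical point for each set of digits, so that equal sets have equal codes.\<close>

definition least_codes :: "real set \<Rightarrow> real set \<Rightarrow> real set" where
  "least_codes C S = {x \<in> C. \<forall>z\<in>C. z < x \<longrightarrow> (\<exists>s\<in>S. digit_at C S s z \<noteq> digit_at C S s x)}"

lemma next_below_range:
  assumes "\<And>n. s (Suc n) < s n"
  shows "next_below (range s) (s n) t \<longleftrightarrow> t = s (Suc n)"
proof -
  have "antimono s" using assms by (intro decseq_SucI less_imp_le)
  have less: "s m < s n \<longleftrightarrow> n < m" for m n
    using lift_Suc_mono_less_iff[of "\<lambda>n. - s n" n m] assms by simp
  have "s m \<le> s (Suc n)" if "s m < s n" for m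
    using that antimonoD[OF \<open>antimono s\<close>, of "Suc n" m] less by simp
  then show ?thesis using assms[of n] unfolding next_below_def
    by (auto simp: image_iff intro!: antisym)
qed

lemma digit_at_range:
  assumes "lacunary C s"
  shows "digit_at C (range s) (s n) x \<longleftrightarrow> digit C (s n) (s (Suc n)) x"
  using assms by (simp add: digit_at_def next_below_range lacunary_def)

lemma bij_betw_least_codes:
  assumes C: "cantor_set C" and s: "lacunary C s"
  shows "bij_betw (\<lambda>x. {n. digit_at C (range s) (s n) x}) (least_codes C (range s)) UNIV"
    (is "bij_betw ?code ?P UNIV")
proof (rule bij_betwI')
  fix x z assume xz: "x \<in> ?P" "z \<in> ?P"
  show "?code x = ?code z \<longleftrightarrow> x = z"
  proof
    assume "?code x = ?code z"
    then have same: "digit_at C (range s) r x = digit_at C (range s) r z" if "r \<in> range s" for r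
      using that by auto
    have "\<not> x < z" using xz same by (auto simp: least_codes_def)
    moreover have "\<not> z < x" using xz same by (auto simp: least_codes_def)
    ultimately show "x = z" by simp
  qed simp
next
  fix A :: "nat set"
  obtain x where x: "x \<in> C" "\<And>n. digit C (s n) (s (Suc n)) x \<longleftrightarrow> n \<in> A"
    "\<And>z. z \<in> C \<Longrightarrow> (\<And>n. digit C (s n) (s (Suc n)) z \<longleftrightarrow> n \<in> A) \<Longrightarrow> x \<le> z"
    using least_element_with_digits[OF C s] by metis
  have "x \<in> ?P"
    unfolding least_codes_def
  proof (intro CollectI conjI ballI impI x(1))
    fix z assume "z \<in> C" "z < x"
    then obtain n where "\<not> (digit C (s n) (s (Suc n)) z \<longleftrightarrow> n \<in> A)"
      using x(3)[of z] by auto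
    then show "\<exists>r\<in>range s. digit_at C (range s) r z \<noteq> digit_at C (range s) r x"
      using x(2)[of n] by (intro bexI[of _ "s n"]) (simp_all add: digit_at_range[OF s])
  qed
  then show "\<exists>x\<in>?P. A = ?code x"
    using x(2) by (auto simp: digit_at_range[OF s])
qed simp

context
  fixes M :: "('f, 'r, real) struct" and p :: "nat \<Rightarrow> real" and C :: "real set"
  assumes M: "expansion_of_real_less_plus M" and C: "\<And>i. expressible M p (\<lambda>e. e i \<in> C)"
begin

lemmas expressible_intros = expressible_not expressible_conj expressible_imp expressible_iff
  expressible_less[OF M] expressible_le[OF M] expressible_eq
  expressible_trm_var expressible_trm_param expressible_trm_add[OF M] C

lemma expressible_gap: "expressible M p (\<lambda>e. gap C (e i) (e j))"
  unfolding gap_def Ball_def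
  by (intro expressible_intros expressible_all[where m = "Suc (i + j)"]) simp

lemma expressible_wide: "expressible M p (\<lambda>e. wide C (e i) (e j) (e k))"
  unfolding wide_def
  by (intro expressible_ex[where m = "Suc (i + j + k)"] expressible_ex[where m = "Suc (Suc (i + j + k))"]
      expressible_intros expressible_gap) simp_all

lemma expressible_near_lengths: "expressible M p (\<lambda>e. e i \<in> near_lengths C (p j) (p k))"
  unfolding near_lengths_def mem_Collect_eq
  by (intro expressible_ex[where m = "Suc i"] expressible_ex[where m = "Suc (Suc i)"]
      expressible_intros expressible_gap) simp_all

lemma expressible_digit: "expressible M p (\<lambda>e. digit C (e i) (e j) (e k))"
  unfolding digit_def Ball_def
  by (intro expressible_all[where m = "Suc (i + j + k)"] expressible_intros expressible_wide) simp

context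
  fixes S :: "real set"
  assumes S: "\<And>i. expressible M p (\<lambda>e. e i \<in> S)"
begin

lemma expressible_next_below: "expressible M p (\<lambda>e. next_below S (e i) (e j))"
  unfolding next_below_def Ball_def
  by (intro expressible_all[where m = "Suc (i + j)"] expressible_intros S) simp

lemma expressible_digit_at: "expressible M p (\<lambda>e. digit_at C S (e i) (e j))"
  unfolding digit_at_def
  by (intro expressible_ex[where m = "Suc (i + j)"] expressible_intros expressible_next_below
      expressible_digit) simp

lemma expressible_least_codes: "expressible M p (\<lambda>e. e i \<in> least_codes C S)"
  unfolding least_codes_def mem_Collect_eq Ball_def Bex_def
  by (intro expressible_all[where m = "Suc i"] expressible_ex[where m = "Suc (Suc i)"]
      expressible_intros S expressible_digit_at) simp_all

end

end

lemma definable_singletons: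
  assumes "expressible M p (\<lambda>e. e 0 \<in> S)"
  shows "definable M 1 ((\<lambda>x. [x]) ` S)"
proof -
  have "(\<lambda>x. [x]) ` S = {xs. length xs = 1 \<and> xs ! 0 \<in> S}"
    by (auto simp: length_Suc_conv)
  then show ?thesis using definable_if_expressible[OF assms, of 1] by simp
qed

lemma definable_pairs:
  assumes "expressible M p (\<lambda>e. R (e 0) (e 1))"
  shows "definable M (1 + 1) {[x, y] | x y. R x y}"
proof -
  have "{[x, y] | x y. R x y} = {xs. length xs = 2 \<and> R (xs ! 0) (xs ! 1)}"
    by (auto simp: length_Suc_conv numeral_2_eq_2)
  then show ?thesis using definable_if_expressible[OF assms, of 2] by (simp add: numeral_2_eq_2)
qed

text \<open>It remains to read off the structure. A number is a scale, its successor is the next smaller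
  scale, and a set of numbers is the least point of \<open>C\<close> with the corresponding digits. The parameters
  are \<open>y\<close>, \<open>u\<close> and those used to define \<open>C\<close>.\<close>

theorem theoremB:
  fixes M :: "('f, 'r, real) struct"
  assumes "expansion_of_real_less_plus M"
    and "defines_cantor_set M"
  shows "defines_structB M"
proof -
  obtain C where C: "cantor_set C" and defC: "definable M 1 ((\<lambda>x. [x]) ` C)"
    using assms(2) by (auto simp: defines_cantor_set_def)
  obtain \<phi> q where \<phi>: "wf_fm M \<phi>"
    and "(\<lambda>x. [x]) ` C = {xs. length xs = 1 \<and> sat M (\<lambda>i. if i < 1 then xs ! i else q i) \<phi>}"
    using defC by (auto simp: definable_def)
  then have "[x] \<in> (\<lambda>x. [x]) ` C \<longleftrightarrow> sat M (\<lambda>i. if i < 1 then [x] ! i else q i) \<phi>" for x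
    by simp
  moreover have "(\<lambda>i. if i < 1 then [x] ! i else q i) = (\<lambda>i. if i < 1 then x else q i)" for x
    by (simp add: fun_eq_iff)
  moreover have "[x] \<in> (\<lambda>x. [x]) ` C \<longleftrightarrow> x \<in> C" for x by blast
  ultimately have "x \<in> C \<longleftrightarrow> sat M (\<lambda>i. if i < 1 then x else q i) \<phi>" for x
    by simp
  then have C_eq: "C = {x. sat M (\<lambda>i. if i < 1 then x else q i) \<phi>}"
    by (intro set_eqI) simp
  obtain y u s where s: "lacunary C s" and near: "near_lengths C y u = range s"
    using lacunary_near_lengths[OF C] .
  define S where "S = range s"
  define P where "P = least_codes C S"
  define p where "p i = (if i = 0 then y else if i = 1 then u else q (i - 2))" for i :: nat
  have exC: "expressible M p (\<lambda>e. e i \<in> C)" for i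
    by (rule expressible_mem[OF C_eq \<phi>, of p 2]) (simp add: p_def)
  have exS: "expressible M p (\<lambda>e. e i \<in> S)" for i
    using expressible_near_lengths[OF assms(1) exC, of i 0 1] near by (simp add: p_def S_def)
  have exP: "expressible M p (\<lambda>e. e i \<in> P)" for i
    unfolding P_def by (rule expressible_least_codes[OF assms(1) exC exS])
  have s_dec: "s (Suc n) < s n" for n using s by (simp add: lacunary_def)
  have "s m \<noteq> s n" if "m < n" for m n
    using lift_Suc_mono_less[of "\<lambda>n. - s n", OF _ that] s_dec by fastforce
  then have "inj s"
    by (rule linorder_injI)
  define rank where "rank = (\<lambda>xs. inv s (hd xs))"
  have rank: "rank [s n] = n" for n using \<open>inj s\<close> by (simp add: rank_def)
  define A where "A = \<lparr>set_sort = (\<lambda>x. [x]) ` P, num_sort = (\<lambda>x. [x]) ` S,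
    memb = {([r], [x]) | r x. r \<in> S \<and> x \<in> P \<and> digit_at C S r x},
    succ = (\<lambda>xs. [s (Suc (rank xs))])\<rparr>"
  have "two_sorted_structure A"
    by (auto simp: two_sorted_structure_def A_def S_def)
  moreover have "definable M 1 (num_sort A)" "definable M 1 (set_sort A)"
    using definable_singletons[OF exS] definable_singletons[OF exP] by (simp_all add: A_def)
  moreover have "definable M (1 + 1) {x @ z | x z. (x, z) \<in> memb A}"
  proof -
    have memb_iff: "(a, b) \<in> memb A \<longleftrightarrow>
        (\<exists>r x. a = [r] \<and> b = [x] \<and> r \<in> S \<and> x \<in> P \<and> digit_at C S r x)" for a b
      unfolding A_def by simp
    have "{x @ z | x z. (x, z) \<in> memb A} = {[r, x] | r x. r \<in> S \<and> x \<in> P \<and> digit_at C S r x}"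
    proof (intro set_eqI iffI)
      fix w assume "w \<in> {x @ z | x z. (x, z) \<in> memb A}"
      then show "w \<in> {[r, x] | r x. r \<in> S \<and> x \<in> P \<and> digit_at C S r x}"
        unfolding memb_iff by auto
    next
      fix w assume "w \<in> {[r, x] | r x. r \<in> S \<and> x \<in> P \<and> digit_at C S r x}"
      then obtain r x where "w = [r] @ [x]" "([r], [x]) \<in> memb A"
        unfolding memb_iff by auto
      then show "w \<in> {x @ z | x z. (x, z) \<in> memb A}" by blast
    qed
    moreover have "expressible M p (\<lambda>e. e 0 \<in> S \<and> e 1 \<in> P \<and> digit_at C S (e 0) (e 1))"
      by (intro expressible_conj exS exP expressible_digit_at[OF assms(1) exC exS])
    ultimately show ?thesis
      using definable_pairs[of M p "\<lambda>r x. r \<in> S \<and> x \<in> P \<and> digit_at C S r x"] by (simp only:)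
  qed
  moreover have "definable M (1 + 1) {x @ succ A x | x. x \<in> num_sort A}"
  proof -
    have num_iff: "a \<in> num_sort A \<longleftrightarrow> (\<exists>n. a = [s n])" for a
      by (auto simp: A_def S_def)
    have succ_s: "succ A [s n] = [s (Suc n)]" for n
      by (simp add: A_def rank)
    have next_iff: "next_below S r t \<longleftrightarrow> (\<exists>n. r = s n \<and> t = s (Suc n))" for r t
    proof -
      have "\<exists>n. r = s n" if "next_below S r t"
        using that by (auto simp: next_below_def S_def)
      then show ?thesis using next_below_range[of s, OF s_dec] unfolding S_def by auto
    qed
    have "{x @ succ A x | x. x \<in> num_sort A} = {[r, t] | r t. next_below S r t}"
      unfolding num_iff next_iff
      by (metis (no_types, lifting) succ_s append_Cons append_Nil)
    then show ?thesis
      using definable_pairs[of M p "next_below S", OF expressible_next_below[OF assms(1) exC exS]]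
      by (simp only:)
  qed
  ultimately have "definable_two_sorted M A"
    unfolding definable_two_sorted_def by blast
  moreover have "two_sorted_iso A structB"
    unfolding two_sorted_iso_def
  proof (intro exI conjI ballI)
    show "bij_betw rank (num_sort A) (num_sort structB)"
      by (rule bij_betw_byWitness[of _ "\<lambda>n. [s n]"])
        (simp_all add: A_def S_def structB_def rank image_subset_iff)
    have "bij_betw hd ((\<lambda>x. [x]) ` P) P"
      by (rule bij_betw_byWitness[of _ "\<lambda>x. [x]"]) auto
    from bij_betw_trans[OF this bij_betw_least_codes[OF C s, folded S_def, folded P_def]]
    show "bij_betw (\<lambda>xs. {n. digit_at C S (s n) (hd xs)}) (set_sort A) (set_sort structB)"
      by (simp add: A_def structB_def comp_def)
    fix n assume "n \<in> num_sort A"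
    then obtain k where n: "n = [s k]" by (auto simp: A_def S_def)
    show "rank (succ A n) = succ structB (rank n)"
      by (simp add: A_def n rank structB_def)
    fix X assume "X \<in> set_sort A"
    then show "(n, X) \<in> memb A \<longleftrightarrow> (rank n, {n. digit_at C S (s n) (hd X)}) \<in> memb structB"
      by (auto simp: A_def n rank structB_def S_def)
  qed
  ultimately show ?thesis by (auto simp: defines_structB_def)
qed

end
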